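(* Let $p>1$ and let $f,g,\rho,d$ satisfy the standing assumptions. Let $u$ be a traveling wave solution, defined in $(\alpha,\beta)$, with some speed $c\in\mathbb R$. Suppose that for some positive constants $c_1,c_2,\delta$ and some $\lambda\in\left(-1,\frac1{p-1}\right]$ we have $$c_1(1-u)^\lambda\le\rho(u)(d(u))^{\frac1{p-1}}\le c_2(1-u)^\lambda\quad\text{for every }u\in(1-\delta,1).$$ Then $$\alpha=-\infty\quad\text{if and only if}\quad\int_{1/2}^1\frac{(1-u)^{\lambda-\frac{\lambda+1}{p}}}{\rho(u)}\,du=+\infty.$$ Moreover, when $\alpha>-\infty$, then $\lim_{t\to\alpha^+}u'(t)=0$.
   Context: Standing assumptions: $p>1$; $f,g,\rho\in C[0,1]$; $d\in C^1(0,1)$; $\rho(u)>0$ in $(0,1)$ and $\rho(0)=\rho(1)=0$; $g(0)>0$ and $\int_0^u g(s)\,ds>0$ for every $u\in(0,1]$; $d(u)>0$ in $(0,1)$ and $\rho\, d^{\frac1{p-1}}\in L^1(0,1)$. A traveling wave solution (t.w.s.) with speed $c\in\mathbb R$ is a function $u\in C^1(\alpha,\beta)$, with $-\infty\le\alpha<\beta\le+\infty$, such that $0<u(t)<1$ for all $t\in(\alpha,\beta)$, $d(u)|u'|^{p-2}u'\in C^1(\alpha,\beta)$, $$(d(u)|u'|^{p-2}u')'+(cg(u)-f(u))u'+\rho(u)=0\quad\text{in }(\alpha,\beta),$$ $u(\alpha^+)=1$, $u(\beta^-)=0$, and $\lim_{t\to\alpha^+}d(u)|u'|^{p-2}u'=\lim_{t\to\beta^-}d(u)|u'|^{p-2}u'=0$.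 *)

theory Defs
  imports "HOL-Analysis.Analysis"
begin

definition standing_assumptions ::
  "real \<Rightarrow> (real \<Rightarrow> real) \<Rightarrow> (real \<Rightarrow> real) \<Rightarrow> (real \<Rightarrow> real) \<Rightarrow> (real \<Rightarrow> real) \<Rightarrow> bool"
where
  "standing_assumptions p f g \<rho> d \<longleftrightarrow>
     p > 1 \<and>
     continuous_on {0..1} f \<and> continuous_on {0..1} g \<and> continuous_on {0..1} \<rho> \<and>
     d C1_differentiable_on {0<..<1} \<and>
     (\<forall>v\<in>{0<..<1}. \<rho> v > 0) \<and> \<rho> 0 = 0 \<and> \<rho> 1 = 0 \<and>
     g 0 > 0 \<and> (\<forall>v\<in>{0<..1}. integral {0..v} g > 0) \<and>
     (\<forall>v\<in>{0<..<1}. d v > 0) \<and>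
     set_integrable lborel {0<..<1} (\<lambda>v. \<rho> v * d v powr (1 / (p - 1)))"

text \<open>The term $d(u)|u'|^{p-2}u'$. Since \<open>0 powr a = 0\<close>, it vanishes where $u' = 0$,
  also for $p < 2$.\<close>

definition flux :: "real \<Rightarrow> (real \<Rightarrow> real) \<Rightarrow> (real \<Rightarrow> real) \<Rightarrow> real \<Rightarrow> real"
where
  "flux p d u t = d (u t) * \<bar>deriv u t\<bar> powr (p - 2) * deriv u t"

text \<open>The endpoints are extended reals. As for \<open>interval_integral_FTC_integrable\<close>, a limit of \<open>h\<close>
  at an endpoint \<open>\<alpha>\<close>, finite or not, is the limit of \<open>h \<circ> real_of_ereal\<close> at \<open>\<alpha>\<close>. The values of
  \<open>u\<close> outside \<open>einterval \<alpha> \<beta>\<close> are irrelevant.\<close>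

definition traveling_wave ::
  "real \<Rightarrow> (real \<Rightarrow> real) \<Rightarrow> (real \<Rightarrow> real) \<Rightarrow> (real \<Rightarrow> real) \<Rightarrow> (real \<Rightarrow> real) \<Rightarrow>
   real \<Rightarrow> ereal \<Rightarrow> ereal \<Rightarrow> (real \<Rightarrow> real) \<Rightarrow> bool"
where
  "traveling_wave p f g \<rho> d c \<alpha> \<beta> u \<longleftrightarrow>
     \<alpha> < \<beta> \<and>
     u C1_differentiable_on einterval \<alpha> \<beta> \<and>
     (\<forall>t\<in>einterval \<alpha> \<beta>. 0 < u t \<and> u t < 1) \<and>
     flux p d u C1_differentiable_on einterval \<alpha> \<beta> \<and>
     (\<forall>t\<in>einterval \<alpha> \<beta>.
        deriv (flux p d u) t + (c * g (u t) - f (u t)) * deriv u t + \<rho> (u t) = 0) \<and>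
     ((u \<circ> real_of_ereal) \<longlongrightarrow> 1) (at_right \<alpha>) \<and>
     ((u \<circ> real_of_ereal) \<longlongrightarrow> 0) (at_left \<beta>) \<and>
     ((flux p d u \<circ> real_of_ereal) \<longlongrightarrow> 0) (at_right \<alpha>) \<and>
     ((flux p d u \<circ> real_of_ereal) \<longlongrightarrow> 0) (at_left \<beta>)"

end

theory Submission
  imports Defs
begin

text \<open>
  A traveling wave is strictly decreasing. Put \<open>n = -u'\<close>, \<open>s = 1 - u\<close>, \<open>q = 1/(p-1)\<close>,
  \<open>w = -flux = d(u) n\<^sup>p\<^sup>-\<^sup>1\<close> and \<open>r = \<rho>(u) d(u)\<^sup>q\<close>. Regarded as a function of \<open>s\<close>, \<open>w\<close> solves the singular
  first order equation \<open>dw/ds = f - c g + r / w\<^sup>q\<close>, \<open>w(0) = 0\<close>, with \<open>r\<close> comparable to \<open>s\<^sup>\<lambda>\<close>.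
  Balancing \<open>dw/ds\<close> against \<open>r / w\<^sup>q\<close> gives the exponent \<open>m = (\<lambda>+1)/(q+1)\<close>; the hypothesis
  \<open>\<lambda> \<le> q\<close> says \<open>m \<le> 1\<close>, so that the bounded term \<open>f - c g\<close> is dominated by \<open>s\<^sup>m\<^sup>-\<^sup>1\<close> and
  multiples of \<open>s\<^sup>m\<close> are barriers on both sides of \<open>w\<close>. Hence \<open>n = w\<^sup>q \<rho>(u) / r\<close> is comparable
  to \<open>\<rho>(u) s\<^sup>1\<^sup>-\<^sup>m\<close>, which tends to 0, and for an antiderivative \<open>F\<close> of the integrand in the
  statement the derivative of \<open>F \<circ> u\<close> lies between two negative constants near \<open>\<alpha>\<close>. So \<open>F\<close> is
  unbounded near 1 exactly when \<open>\<alpha> = -\<infinity>\<close>.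
\<close>

section \<open>Intervals with extended real endpoints and limits at the left endpoint\<close>

lemma einterval_subset_left:
  assumes "x \<in> einterval a b" "y \<in> einterval a (ereal x)"
  shows "y \<in> einterval a b"
  using assms less_trans[of "ereal y" "ereal x" b] by (simp add: einterval_def)

text \<open>The filter at \<open>\<alpha>\<close> lives on the extended reals. Density of the reals
  replaces its neighbourhood bound by a real point of the interval, for finite
  \<open>\<alpha>\<close> and \<open>-\<infinity>\<close> alike.\<close>

lemma eventually_at_right_einterval:
  fixes \<alpha> \<beta> :: ereal
  assumes "\<alpha> < \<beta>"
  shows "eventually P (at_right \<alpha>) \<longleftrightarrow> (\<exists>b\<in>einterval \<alpha> \<beta>. \<forall>t\<in>einterval \<alpha> (ereal b). P (ereal t))"
proof
  assume "eventually P (at_right \<alpha>)"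
  then obtain b where b: "\<alpha> < b" "\<And>y. \<alpha> < y \<Longrightarrow> y < b \<Longrightarrow> P y"
    using eventually_at_right[OF assms] by blast
  have "\<alpha> < min b \<beta>" using b assms by simp
  then obtain r where "\<alpha> < ereal r" "ereal r < min b \<beta>" using ereal_dense2 by blast
  then show "\<exists>b\<in>einterval \<alpha> \<beta>. \<forall>t\<in>einterval \<alpha> (ereal b). P (ereal t)"
    using b less_trans[of _ "ereal r" b] by (intro bexI[of _ r]) (auto simp: einterval_def)
next
  assume "\<exists>b\<in>einterval \<alpha> \<beta>. \<forall>t\<in>einterval \<alpha> (ereal b). P (ereal t)"
  then obtain b where b: "b \<in> einterval \<alpha> \<beta>" "\<And>t. t \<in> einterval \<alpha> (ereal b) \<Longrightarrow> P (ereal t)"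
    by blast
  have "P y" if "\<alpha> < y" "y < ereal b" for y
    using b(2)[of "real_of_ereal y"] that by (cases y) (auto simp: einterval_def)
  then show "eventually P (at_right \<alpha>)"
    using eventually_at_right[OF assms] b(1) by (auto simp: einterval_def)
qed

lemma einterval_at_right_less:
  assumes "((\<phi> \<circ> real_of_ereal) \<longlongrightarrow> l) (at_right \<alpha>)" and "l < a" and "t \<in> einterval \<alpha> b"
  obtains x where "x \<in> einterval \<alpha> (ereal t)" "\<phi> x < (a::real)"
proof -
  have "\<alpha> < ereal t" using assms by (simp add: einterval_def)
  moreover have "eventually (\<lambda>y. (\<phi> \<circ> real_of_ereal) y < a) (at_right \<alpha>)"
    using assms by (intro order_tendstoD)
  ultimately obtain b' where b': "b' \<in> einterval \<alpha> (ereal t)"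
    "\<And>x. x \<in> einterval \<alpha> (ereal b') \<Longrightarrow> \<phi> x < a"
    by (subst (asm) eventually_at_right_einterval) auto
  obtain x where "\<alpha> < ereal x" "ereal x < ereal b'"
    using b'(1) ereal_dense2[of \<alpha> "ereal b'"] by (auto simp: einterval_def)
  with b' that show thesis by (force simp: einterval_def)
qed

lemma einterval_mem_between:
  assumes "x \<in> einterval a b" "y \<in> einterval a b" "x \<le> z" "z \<le> y"
  shows "z \<in> einterval a b"
  using assms unfolding einterval_def
  by (auto intro: less_le_trans[of a "ereal x"] le_less_trans[of _ "ereal y"])

section \<open>Barriers for a singular first order equation\<close>

text \<open>If \<open>\<phi> t > 0\<close>, the limit 0 at \<open>\<alpha>\<close> yields
  \<open>x < t\<close> with \<open>\<phi> x < \<phi> t\<close>. The maximum over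
  \<open>{x..t}\<close> is then positive and is not attained at \<open>x\<close>, but the negative
  derivative there gives larger values just to its left. No Lipschitz condition enters, so the
  comparison suits a singular equation.\<close>

lemma nonpos_if_decreasing_where_positive:
  fixes \<phi> :: "real \<Rightarrow> real"
  assumes lim: "((\<phi> \<circ> real_of_ereal) \<longlongrightarrow> 0) (at_right \<alpha>)"
    and der: "\<And>t. t \<in> einterval \<alpha> b \<Longrightarrow> (\<phi> has_real_derivative \<phi>' t) (at t)"
    and neg: "\<And>t. t \<in> einterval \<alpha> b \<Longrightarrow> \<phi> t > 0 \<Longrightarrow> \<phi>' t < 0"
    and t: "t \<in> einterval \<alpha> b"
  shows "\<phi> t \<le> 0"
proof (rule ccontr)
  assume pos: "\<not> \<phi> t \<le> 0"
  then obtain x where x: "x \<in> einterval \<alpha> (ereal t)" "\<phi> x < \<phi> t"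
    using einterval_at_right_less[OF lim _ t, of "\<phi> t"] by auto
  have xt: "x < t" using x by (simp add: einterval_def)
  have xI: "x \<in> einterval \<alpha> b" using einterval_subset_left[OF t x(1)] .
  have I: "z \<in> einterval \<alpha> b" if "z \<in> {x..t}" for z
    using einterval_mem_between[OF xI t] that by simp
  have "continuous_on {x..t} \<phi>"
    by (intro continuous_at_imp_continuous_on ballI DERIV_isCont[OF der] I)
  then obtain y where y: "y \<in> {x..t}" "\<And>z. z \<in> {x..t} \<Longrightarrow> \<phi> z \<le> \<phi> y"
    using continuous_attains_sup[of "{x..t}" \<phi>] xt by auto
  have "\<phi> t \<le> \<phi> y" using y(2)[of t] xt by simp
  then have "\<phi>' y < 0" using neg[OF I[OF y(1)]] pos by simp
  moreover have "x < y" using y(1) \<open>\<phi> t \<le> \<phi> y\<close> x by (cases "x = y") auto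
  \<comment> \<open>The maximum may sit at the right end \<open>t\<close>, so the contradiction is
    sought to the left of \<open>y\<close>.\<close>
  ultimately obtain e where e: "e > 0" "\<And>h. 0 < h \<Longrightarrow> h < e \<Longrightarrow> \<phi> y < \<phi> (y - h)"
    using DERIV_neg_dec_left[OF der[OF I[OF y(1)]]] by blast
  define h where "h = min (e / 2) (y - x)"
  have "0 < h" "h < e" "y - h \<in> {x..t}" using e(1) \<open>x < y\<close> y(1) by (auto simp: h_def)
  then show False using e(2)[of h] y(2)[of "y - h"] by auto
qed

text \<open>Along a barrier \<open>K * s powr m\<close>, its slope in \<open>s\<close>, the bound
  for \<open>k\<close> and the singular term are all controlled by multiples of
  \<open>s powr (m - 1)\<close>. Choosing a barrier thus reduces to a numerical inequality for
  \<open>K\<close>, solvable for large \<open>K\<close> from above and for small \<open>K\<close>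
  from below.\<close>

lemma power_bounds_of_profile:
  fixes s w n k r :: "real \<Rightarrow> real"
  assumes lim_s: "((s \<circ> real_of_ereal) \<longlongrightarrow> 0) (at_right \<alpha>)"
    and lim_w: "((w \<circ> real_of_ereal) \<longlongrightarrow> 0) (at_right \<alpha>)"
    and s: "\<And>t. t \<in> einterval \<alpha> b \<Longrightarrow> 0 < s t \<and> s t \<le> 1"
    and w: "\<And>t. t \<in> einterval \<alpha> b \<Longrightarrow> w t > 0"
    and n: "\<And>t. t \<in> einterval \<alpha> b \<Longrightarrow> n t > 0"
    and ds: "\<And>t. t \<in> einterval \<alpha> b \<Longrightarrow> (s has_real_derivative n t) (at t)"
    and dw: "\<And>t. t \<in> einterval \<alpha> b \<Longrightarrow>
               (w has_real_derivative n t * (k t + r t / w t powr q)) (at t)"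
    and k: "\<And>t. t \<in> einterval \<alpha> b \<Longrightarrow> \<bar>k t\<bar> \<le> M"
    and r: "\<And>t. t \<in> einterval \<alpha> b \<Longrightarrow> c1 * s t powr l \<le> r t \<and> r t \<le> c2 * s t powr l"
    and q: "q > 0" and m: "0 < m" "m \<le> 1" "l - q * m = m - 1"
    and c: "c1 > 0" "c2 > 0"
  obtains K1 K2 where "K1 > 0" "K2 > 0"
    "\<And>t. t \<in> einterval \<alpha> b \<Longrightarrow> K1 * s t powr m \<le> w t \<and> w t \<le> K2 * s t powr m"
proof (cases "einterval \<alpha> b = {}")
  case True
  then show ?thesis using that[of 1 1] by auto
next
  case False
  then obtain t0 where t0: "t0 \<in> einterval \<alpha> b" by blast
  have M: "M \<ge> 0" using k[OF t0] by linarith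
  have \<alpha>b: "\<alpha> < b" using t0 by (auto simp: einterval_def intro: less_trans)
  \<comment> \<open>The base tends to 0, where \<open>tendsto_powr'\<close> asks for a positive
    exponent and an eventually nonnegative base.\<close>
  have lim_sm: "((\<lambda>x. s (real_of_ereal x) powr m) \<longlongrightarrow> 0) (at_right \<alpha>)"
  proof -
    have "eventually (\<lambda>x. 0 \<le> s (real_of_ereal x)) (at_right \<alpha>)"
    proof (subst eventually_at_right_einterval[OF \<alpha>b], intro bexI[of _ t0] ballI)
      fix t assume "t \<in> einterval \<alpha> (ereal t0)"
      then have "t \<in> einterval \<alpha> b" by (rule einterval_subset_left[OF t0])
      then show "0 \<le> s (real_of_ereal (ereal t))" using s[of t] by simp
    qed (rule t0)
    then have "((\<lambda>x. s (real_of_ereal x) powr m) \<longlongrightarrow> 0 powr m) (at_right \<alpha>)"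
      using lim_s m(1) unfolding o_def by (intro tendsto_powr') auto
    then show ?thesis by simp
  qed
  have lim: "(((\<lambda>t. w t - K * s t powr m) \<circ> real_of_ereal) \<longlongrightarrow> 0) (at_right \<alpha>)" for K
    using tendsto_diff[OF lim_w[unfolded o_def] tendsto_mult[OF tendsto_const[of K] lim_sm]]
    by (simp add: o_def)
  let ?D = "\<lambda>K t. n t * (k t + r t / w t powr q) - K * (m * s t powr (m - 1) * n t)"
  have der: "((\<lambda>t. w t - K * s t powr m) has_real_derivative ?D K t) (at t)"
    if "t \<in> einterval \<alpha> b" for K t
    using dw[OF that] ds[OF that] s[OF that]
    by (auto intro!: derivative_eq_intros simp: powr_diff)
  \<comment> \<open>Here \<open>m \<le> 1\<close> and \<open>s \<le> 1\<close> enter: the bounded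
    term \<open>k\<close> is absorbed into a multiple of \<open>s powr (m - 1)\<close>.\<close>
  have s1: "1 \<le> s t powr (m - 1)" if "t \<in> einterval \<alpha> b" for t
    using powr_mono'[of "m - 1" 0 "s t"] s[OF that] m by simp
  have Mk: "- (M * s t powr (m - 1)) \<le> k t" "k t \<le> M * s t powr (m - 1)" if "t \<in> einterval \<alpha> b" for t
    using k[OF that] mult_left_mono[OF s1[OF that] M] by linarith+
  \<comment> \<open>On the barrier the singular term carries the same power of \<open>s\<close> as
    the slope of the barrier; this is the meaning of \<open>l - q * m = m - 1\<close>.\<close>
  have quot: "C * s t powr l / (K * s t powr m) powr q = C * K powr (-q) * s t powr (m - 1)"
    if "t \<in> einterval \<alpha> b" "K > 0" for C K t
  proof -
    have "C * s t powr l / (K * s t powr m) powr q = C * K powr (-q) * (s t powr l / s t powr (q * m))"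
      using that s[OF that(1)] by (simp add: powr_mult powr_powr powr_minus field_simps)
    also have "s t powr l / s t powr (q * m) = s t powr (m - 1)"
      using m(3) by (simp flip: powr_diff)
    finally show ?thesis .
  qed
  \<comment> \<open>For \<open>K2 \<ge> 1\<close> the factor \<open>K2 powr (-q)\<close> is at most
    1, so \<open>K2 * m > M + c2\<close> suffices; the summand 1 makes this strict.\<close>
  define K2 where "K2 = (M + c2) / m + 1"
  have K2: "K2 \<ge> 1" using M c m by (simp add: K2_def)
  have K2': "M + c2 * K2 powr (-q) < K2 * m"
  proof -
    have "K2 powr (-q) \<le> 1" using K2 q powr_mono[of "-q" 0 K2] by simp
    then have "c2 * K2 powr (-q) \<le> c2" using c mult_left_mono[of _ 1 c2] by simp
    moreover have "K2 * m = M + c2 + m" using m by (simp add: K2_def field_simps)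
    ultimately show ?thesis using m by simp
  qed
  \<comment> \<open>\<open>A\<close> is the value intended for \<open>K1 powr (-q)\<close>: then
    \<open>c1 * A = M + m + c1\<close>, which exceeds \<open>M + K1 * m\<close> once
    \<open>K1 \<le> 1\<close>.\<close>
  define A where "A = (M + m) / c1 + 1"
  have A: "A > 1" using M c m by (simp add: A_def add_nonneg_pos)
  define K1 where "K1 = A powr (- (1 / q))"
  have K1: "K1 > 0" "K1 \<le> 1"
    using A q powr_mono[of "- (1 / q)" 0 A] by (simp_all add: K1_def)
  have K1': "K1 * m < c1 * K1 powr (-q) - M"
  proof -
    have "K1 powr (-q) = A" using A q by (simp add: K1_def powr_powr)
    moreover have "c1 * A = M + m + c1" using c by (simp add: A_def field_simps)
    moreover have "K1 * m \<le> m" using K1 m mult_right_mono[of K1 1 m] by simp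
    ultimately show ?thesis using c by simp
  qed
  have up: "w t - K2 * s t powr m \<le> 0" if "t \<in> einterval \<alpha> b" for t
  proof (rule nonpos_if_decreasing_where_positive[OF lim der _ that])
    fix t assume t: "t \<in> einterval \<alpha> b" and gt: "w t - K2 * s t powr m > 0"
    let ?S = "s t powr (m - 1)"
    have S: "?S > 0" using s[OF t] by simp
    \<comment> \<open>Above the barrier \<open>w\<close> is larger, so the singular term is at most
      its value on the barrier and the difference decreases.\<close>
    have "r t / w t powr q \<le> (c2 * s t powr l) / (K2 * s t powr m) powr q"
      using r[OF t] s[OF t] gt K2 q w[OF t] c
      by (intro frac_le powr_mono2) auto
    also have "\<dots> = c2 * K2 powr (-q) * ?S" using quot[OF t] K2 by simp
    finally have "k t + r t / w t powr q \<le> (M + c2 * K2 powr (-q)) * ?S"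
      using Mk[OF t] by (simp add: algebra_simps)
    also have "\<dots> < K2 * m * ?S" using K2' S by (intro mult_strict_right_mono)
    finally have "n t * (k t + r t / w t powr q) < n t * (K2 * m * ?S)"
      using n[OF t] by (rule mult_strict_left_mono)
    then show "?D K2 t < 0" by (simp add: mult_ac)
  qed auto
  \<comment> \<open>The same comparison with reversed sign: below the barrier the singular term is
    at least its value on it.\<close>
  have lo: "- (w t - K1 * s t powr m) \<le> 0" if "t \<in> einterval \<alpha> b" for t
  proof (rule nonpos_if_decreasing_where_positive[OF _ _ _ that])
    show "(((\<lambda>t. - (w t - K1 * s t powr m)) \<circ> real_of_ereal) \<longlongrightarrow> 0) (at_right \<alpha>)"
      using tendsto_minus[OF lim[of K1]] by (simp add: o_def)
    show "((\<lambda>t. - (w t - K1 * s t powr m)) has_real_derivative - ?D K1 t) (at t)"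
      if "t \<in> einterval \<alpha> b" for t
      using DERIV_minus[OF der[OF that]] .
  next
    fix t assume t: "t \<in> einterval \<alpha> b" and gt: "- (w t - K1 * s t powr m) > 0"
    let ?S = "s t powr (m - 1)"
    have S: "?S > 0" using s[OF t] by simp
    have "K1 * m * ?S < (c1 * K1 powr (-q) - M) * ?S"
      using K1' S by (intro mult_strict_right_mono)
    also have "\<dots> = (c1 * s t powr l) / (K1 * s t powr m) powr q - M * ?S"
      using quot[OF t K1(1)] by (simp add: algebra_simps)
    also have "(c1 * s t powr l) / (K1 * s t powr m) powr q \<le> r t / w t powr q"
      using r[OF t] s[OF t] gt K1 q w[OF t] c order_trans[of 0 "c1 * s t powr l" "r t"]
      by (intro frac_le powr_mono2) auto
    finally have "K1 * m * ?S < k t + r t / w t powr q"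
      using Mk[OF t] by (simp add: algebra_simps)
    then have "n t * (K1 * m * ?S) < n t * (k t + r t / w t powr q)"
      using n[OF t] by (rule mult_strict_left_mono)
    then show "- ?D K1 t < 0" by (simp add: mult_ac)
  qed
  show ?thesis
    using that[of K1 K2] K1 K2 up lo by fastforce
qed

section \<open>Strict monotonicity of traveling waves\<close>

lemma traveling_wave_DERIV:
  assumes "traveling_wave p f g \<rho> d c \<alpha> \<beta> u" and "t \<in> einterval \<alpha> \<beta>"
  shows "(u has_real_derivative deriv u t) (at t)"
    and "(flux p d u has_real_derivative deriv (flux p d u) t) (at t)"
proof -
  have "u differentiable (at t)" "flux p d u differentiable (at t)"
    using assms unfolding traveling_wave_def C1_differentiable_on_eq by blast+
  then show "(u has_real_derivative deriv u t) (at t)"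
    "(flux p d u has_real_derivative deriv (flux p d u) t) (at t)"
    by (simp_all only: DERIV_deriv_iff_real_differentiable)
qed

text \<open>At a critical point the equation reads \<open>flux' = - \<rho> < 0\<close>, so every critical point is a strict
  local maximum; since \<open>u\<close> tends to its supremum at \<open>\<alpha>\<close>, there is none.\<close>

lemma traveling_wave_deriv_neg:
  assumes sa: "standing_assumptions p f g \<rho> d"
    and tw: "traveling_wave p f g \<rho> d c \<alpha> \<beta> u"
    and t: "t \<in> einterval \<alpha> \<beta>"
  shows "deriv u t < 0"
proof -
  let ?I = "einterval \<alpha> \<beta>" and ?F = "flux p d u"
  note Du = traveling_wave_DERIV(1)[OF tw] and DF = traveling_wave_DERIV(2)[OF tw]
  have u01: "u x \<in> {0<..<1}" if "x \<in> ?I" for x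
    using tw that unfolding traveling_wave_def by simp
  \<comment> \<open>\<open>u\<close> is not assumed twice differentiable. Second order information
    comes from the derivative of the flux, which shares the sign of \<open>deriv u\<close>.\<close>
  have sgnF: "?F x > 0 \<longleftrightarrow> deriv u x > 0" "?F x < 0 \<longleftrightarrow> deriv u x < 0"  if "x \<in> ?I" for x
  proof -
    have "d (u x) > 0" using sa u01[OF that] unfolding standing_assumptions_def by blast
    then show "?F x > 0 \<longleftrightarrow> deriv u x > 0" "?F x < 0 \<longleftrightarrow> deriv u x < 0"
      unfolding flux_def zero_less_mult_iff mult_less_0_iff by auto
  qed
  have crit: "?F x = 0 \<and> deriv ?F x < 0" if "x \<in> ?I" "deriv u x = 0" for x
  proof
    show "?F x = 0" by (simp add: flux_def that)
    have "deriv ?F x + (c * g (u x) - f (u x)) * deriv u x + \<rho> (u x) = 0"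
      using tw that(1) unfolding traveling_wave_def by blast
    moreover have "\<rho> (u x) > 0"
      using sa u01[OF that(1)] unfolding standing_assumptions_def by blast
    ultimately show "deriv ?F x < 0" using that(2) by simp
  qed
  have opn: "\<exists>e>0. \<forall>y. \<bar>y - x\<bar> < e \<longrightarrow> y \<in> ?I" if "x \<in> ?I" for x
    using open_einterval[of \<alpha> \<beta>] that unfolding open_dist dist_real_def by blast
  \<comment> \<open>If \<open>u\<close> increased at \<open>x\<close>, it would still take a larger
    value at some \<open>a < x\<close>, as it tends to 1 at \<open>\<alpha>\<close>. Its minimum
    over \<open>{a..x}\<close> would be an interior critical point, to the right of which
    \<open>u\<close> falls below that minimum.\<close>
  have no_pos: False if x: "x \<in> ?I" and dx: "deriv u x > 0" for x
  proof -
    have "(((\<lambda>t. - u t) \<circ> real_of_ereal) \<longlongrightarrow> - 1) (at_right \<alpha>)"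
      using tw unfolding traveling_wave_def o_def by (intro tendsto_minus) auto
    then obtain a where a: "a \<in> einterval \<alpha> (ereal x)" "- u a < - u x"
      using u01[OF x] by (elim einterval_at_right_less[OF _ _ x, of _ _ "- u x"]) auto
    have ax: "a < x" using a by (simp add: einterval_def)
    have aI: "a \<in> ?I" using einterval_subset_left[OF x a(1)] .
    have I: "z \<in> ?I" if "z \<in> {a..x}" for z
      using einterval_mem_between[OF aI x] that by simp
    have "continuous_on {a..x} u"
      by (intro continuous_at_imp_continuous_on ballI DERIV_isCont[OF Du] I)
    then obtain y where y: "y \<in> {a..x}" "\<And>z. z \<in> {a..x} \<Longrightarrow> u y \<le> u z"
      using continuous_attains_inf[of "{a..x}" u] ax by auto
    have "a \<noteq> y" using y(2)[of x] a ax by auto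
    moreover have "y \<noteq> x"
    proof
      assume "y = x"
      obtain e where e: "e > 0" "\<And>h. 0 < h \<Longrightarrow> h < e \<Longrightarrow> u (x - h) < u x"
        using DERIV_pos_inc_left[OF Du[OF x] dx] by blast
      define h where "h = min (e / 2) (x - a)"
      have "0 < h" "h < e" "x - h \<in> {a..x}" using e(1) ax by (auto simp: h_def)
      then show False using e(2)[of h] y(2)[of "x - h"] \<open>y = x\<close> by auto
    qed
    ultimately have ay: "a < y" "y < x" using y(1) by auto
    have yI: "y \<in> ?I" using I y by blast
    have "deriv u y = 0"
      using ay y(2) by (intro DERIV_local_min[OF Du[OF yI], of "min (y - a) (x - y)"])
         (auto simp: abs_less_iff intro!: y(2))
    from crit[OF yI this] obtain e where e: "e > 0" "\<And>h. 0 < h \<Longrightarrow> h < e \<Longrightarrow> ?F (y + h) < 0"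
      using DERIV_neg_dec_right[OF DF[OF yI]] by auto
    \<comment> \<open>Capping at \<open>x\<close> keeps \<open>z\<close> in the interval over which
      \<open>y\<close> is minimal.\<close>
    define z where "z = min (y + e / 2) x"
    have z: "y < z" "z \<le> x" using e(1) ay by (auto simp: z_def)
    have "u z < u y"
    proof (rule DERIV_neg_imp_decreasing_open[OF z(1)])
      show "\<exists>D. (u has_real_derivative D) (at v) \<and> D < 0" if "y < v" "v < z" for v
      proof -
        have vI: "v \<in> ?I" using I[of v] that z ay by auto
        have "?F v < 0" using e(2)[of "v - y"] that by (auto simp: z_def)
        then show ?thesis using Du[OF vI] sgnF(2)[OF vI] by blast
      qed
      show "continuous_on {y..z} u"
        by (rule continuous_on_subset[OF \<open>continuous_on {a..x} u\<close>]) (use z ay in auto)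
    qed
    then show False using y(2)[of z] z ay by auto
  qed
  \<comment> \<open>Just to the left of a critical point the flux, and with it
    \<open>deriv u\<close>, would be positive, which \<open>no_pos\<close> excludes.\<close>
  have "deriv u t \<noteq> 0"
  proof
    assume "deriv u t = 0"
    from crit[OF t this] obtain e where e: "e > 0" "\<And>h. 0 < h \<Longrightarrow> h < e \<Longrightarrow> ?F (t - h) > 0"
      using DERIV_neg_dec_left[OF DF[OF t]] by auto
    from opn[OF t] obtain e' where e': "e' > 0" "\<And>y. \<bar>y - t\<bar> < e' \<Longrightarrow> y \<in> ?I" by blast
    define h where "h = min e e' / 2"
    have h: "0 < h" "h < e" "h < e'" using e(1) e'(1) by (auto simp: h_def)
    have "t - h \<in> ?I" using e'(2) h by simp
    with e(2)[OF h(1,2)] show False using no_pos sgnF(1) by blast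
  qed
  then show ?thesis using no_pos[OF t] by fastforce
qed

section \<open>Two-sided bounds for the slope near \<open>\<alpha>\<close>\<close>

lemma traveling_wave_speed_bounds:
  assumes sa: "standing_assumptions p f g \<rho> d"
    and tw: "traveling_wave p f g \<rho> d c \<alpha> \<beta> u"
    and c: "c1 > 0" "c2 > 0" and \<delta>: "\<delta> > 0"
    and l: "-1 < l" "l \<le> 1 / (p - 1)"
    and bd: "\<forall>v\<in>{0<..<1} \<inter> {1 - \<delta><..<1}.
           c1 * (1 - v) powr l \<le> \<rho> v * d v powr (1 / (p - 1)) \<and>
           \<rho> v * d v powr (1 / (p - 1)) \<le> c2 * (1 - v) powr l"
  obtains A B b where "A > 0" "B > 0" "b \<in> einterval \<alpha> \<beta>"
    "\<And>t. t \<in> einterval \<alpha> (ereal b) \<Longrightarrow> u t > 1 / 2 \<and>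
       A * (\<rho> (u t) / (1 - u t) powr (l - (l + 1) / p)) \<le> - deriv u t \<and>
       - deriv u t \<le> B * (\<rho> (u t) / (1 - u t) powr (l - (l + 1) / p))"
proof -
  define q where "q = 1 / (p - 1)"
  \<comment> \<open>This is the balancing exponent \<open>(l + 1) / (q + 1)\<close>, since
    \<open>q + 1 = p / (p - 1)\<close>, written so that \<open>m - 1\<close> is the exponent in the
    statement.\<close>
  define m where "m = l - (l + 1) / p + 1"
  have p: "p > 1" using sa unfolding standing_assumptions_def by blast
  have q: "q > 0" "(p - 1) * q = 1" using p by (simp_all add: q_def)
  have m_eq: "m = (l + 1) * (p - 1) / p" using p by (simp add: m_def field_simps)
  then have "q * m = (l + 1) / p" using p by (simp add: q_def)
  then have m: "l - q * m = m - 1" unfolding m_def by linarith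
  have m0: "m > 0" using p l(1) by (simp add: m_eq)
  have "l * (p - 1) \<le> 1" using l(2) p by (simp add: field_simps)
  then have "l \<le> (l + 1) / p" using p by (simp add: field_simps)
  then have m1: "m \<le> 1" by (simp add: m_def)
  have \<alpha>\<beta>: "\<alpha> < \<beta>" and lim_u: "((u \<circ> real_of_ereal) \<longlongrightarrow> 1) (at_right \<alpha>)"
    and lim_F: "((flux p d u \<circ> real_of_ereal) \<longlongrightarrow> 0) (at_right \<alpha>)"
    using tw unfolding traveling_wave_def by simp_all
  \<comment> \<open>Near \<open>\<alpha>\<close> the wave exceeds \<open>1 - \<delta>\<close>, where
    the bounds on \<open>\<rho>\<close> and \<open>d\<close> hold, and 1/2, where the integral
    begins.\<close>
  have "eventually (\<lambda>x. max (1 - \<delta>) (1 / 2) < (u \<circ> real_of_ereal) x) (at_right \<alpha>)"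
    using \<delta> by (intro order_tendstoD(1)[OF lim_u]) auto
  then obtain b where b: "b \<in> einterval \<alpha> \<beta>"
    "\<And>t. t \<in> einterval \<alpha> (ereal b) \<Longrightarrow> max (1 - \<delta>) (1 / 2) < u t"
    using eventually_at_right_einterval[OF \<alpha>\<beta>] by auto
  let ?J = "einterval \<alpha> (ereal b)"
  have sub: "t \<in> einterval \<alpha> \<beta>" if "t \<in> ?J" for t
    using einterval_subset_left[OF b(1) that] .
  have u01: "u t \<in> {0<..<1} \<inter> {1 - \<delta><..<1}" if "t \<in> ?J" for t
    using tw sub[OF that] b(2)[OF that] unfolding traveling_wave_def by simp
  define n where "n = (\<lambda>t. - deriv u t)"
  define s where "s = (\<lambda>t. 1 - u t)"
  define w where "w = (\<lambda>t. - flux p d u t)"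
  define r where "r = (\<lambda>t. \<rho> (u t) * d (u t) powr q)"
  have n: "n t > 0" if "t \<in> ?J" for t
    using traveling_wave_deriv_neg[OF sa tw sub[OF that]] by (simp add: n_def)
  have s: "0 < s t \<and> s t \<le> 1" if "t \<in> ?J" for t
    using u01[OF that] by (simp add: s_def)
  have pos: "\<rho> (u t) > 0" "d (u t) > 0" if "t \<in> ?J" for t
    using sa u01[OF that] unfolding standing_assumptions_def by blast+
  have weq: "w t = d (u t) * n t powr (p - 1)" if "t \<in> ?J" for t
  proof -
    have "w t = d (u t) * (n t * n t powr (p - 2))"
      using n[OF that] by (simp add: w_def flux_def n_def)
    then show ?thesis using n[OF that] powr_mult_base[of "n t" "p - 2"] by simp
  qed
  have w: "w t > 0" if "t \<in> ?J" for t
    using weq[OF that] pos[OF that] n[OF that] by simp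
  \<comment> \<open>Since \<open>(p - 1) * q = 1\<close>, this power isolates \<open>n\<close>. It
    gives \<open>\<rho> (u t) = n t * r t / w t powr q\<close>, so that the whole equation has the
    factor \<open>n\<close>, the derivative of \<open>s\<close>.\<close>
  have wq: "w t powr q = d (u t) powr q * n t" if "t \<in> ?J" for t
    using weq[OF that] pos[OF that] n[OF that] q by (simp add: powr_mult powr_powr)
  have r: "c1 * s t powr l \<le> r t \<and> r t \<le> c2 * s t powr l" if "t \<in> ?J" for t
    using bd u01[OF that] unfolding r_def s_def q_def by blast
  have ds: "(s has_real_derivative n t) (at t)" if "t \<in> ?J" for t
    unfolding s_def n_def
    by (auto intro!: derivative_eq_intros traveling_wave_DERIV(1)[OF tw] sub that)
  have dw: "(w has_real_derivative n t * (f (u t) - c * g (u t) + r t / w t powr q)) (at t)"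
    if "t \<in> ?J" for t
  proof -
    have "deriv (flux p d u) t + (c * g (u t) - f (u t)) * deriv u t + \<rho> (u t) = 0"
      using tw sub[OF that] unfolding traveling_wave_def by blast
    then have "- deriv (flux p d u) t = n t * (f (u t) - c * g (u t)) + \<rho> (u t)"
      by (simp add: n_def algebra_simps)
    also have "\<dots> = n t * (f (u t) - c * g (u t) + r t / w t powr q)"
      using n[OF that] pos[OF that] by (simp add: wq[OF that] r_def field_simps)
    finally show ?thesis
      using DERIV_minus[OF traveling_wave_DERIV(2)[OF tw sub[OF that]]] by (simp add: w_def)
  qed
  have "continuous_on {0..1} (\<lambda>v. f v - c * g v)"
    using sa unfolding standing_assumptions_def by (intro continuous_intros) auto
  then have "bounded ((\<lambda>v. f v - c * g v) ` {0..1})"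
    by (intro compact_imp_bounded compact_continuous_image) auto
  then obtain M where M: "\<forall>v\<in>{0..1}. \<bar>f v - c * g v\<bar> \<le> M"
    unfolding bounded_iff by auto
  have k: "\<bar>f (u t) - c * g (u t)\<bar> \<le> M" if "t \<in> ?J" for t
    using M u01[OF that] by simp
  have lim_s: "((s \<circ> real_of_ereal) \<longlongrightarrow> 0) (at_right \<alpha>)"
    using tendsto_diff[OF tendsto_const[of 1] lim_u] by (simp add: s_def o_def)
  have lim_w: "((w \<circ> real_of_ereal) \<longlongrightarrow> 0) (at_right \<alpha>)"
    using tendsto_minus[OF lim_F] by (simp add: w_def o_def)
  obtain K1 K2 where K: "K1 > 0" "K2 > 0"
    "\<And>t. t \<in> ?J \<Longrightarrow> K1 * s t powr m \<le> w t \<and> w t \<le> K2 * s t powr m"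
    using power_bounds_of_profile[OF lim_s lim_w s w n ds dw k r q(1) m0 m1 m c] by blast
  define A where "A = K1 powr q / c2"
  define B where "B = K2 powr q / c1"
  have "u t > 1 / 2 \<and> A * (\<rho> (u t) / s t powr (m - 1)) \<le> n t \<and>
      n t \<le> B * (\<rho> (u t) / s t powr (m - 1))" if t: "t \<in> ?J" for t
  proof -
    have rpos: "r t > 0" using pos[OF t] by (simp add: r_def)
    have nt: "n t = \<rho> (u t) * (w t powr q / r t)"
      using pos[OF t] by (simp add: wq[OF t] r_def field_simps)
    have KS: "(K * s t powr m) powr q / (C * s t powr l) = K powr q / C / s t powr (m - 1)"
      if "K > 0" "C > 0" for K C
    proof -
      have "s t powr (m - 1) = s t powr l / s t powr (q * m)"
        by (simp add: m flip: powr_diff)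
      then show ?thesis using s[OF t] that
        by (simp add: powr_mult powr_powr mult_ac)
    qed
    have "w t powr q / r t \<le> (K2 * s t powr m) powr q / (c1 * s t powr l)"
      using K r[OF t] w[OF t] rpos c s[OF t] q t
      by (intro frac_le powr_mono2) (auto simp: less_imp_le)
    then have "w t powr q / r t \<le> B / s t powr (m - 1)"
      using KS[OF K(2) c(1)] by (simp add: B_def)
    then have up: "n t \<le> \<rho> (u t) * (B / s t powr (m - 1))"
      unfolding nt using pos[OF t] by (intro mult_left_mono) auto
    have "(K1 * s t powr m) powr q / (c2 * s t powr l) \<le> w t powr q / r t"
      using K r[OF t] w[OF t] rpos c s[OF t] q t
      by (intro frac_le powr_mono2) (auto simp: less_imp_le)
    then have "A / s t powr (m - 1) \<le> w t powr q / r t"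
      using KS[OF K(1) c(2)] by (simp add: A_def)
    then have "\<rho> (u t) * (A / s t powr (m - 1)) \<le> n t"
      unfolding nt using pos[OF t] by (intro mult_left_mono) auto
    with up b(2)[OF t] show ?thesis by (simp add: mult_ac)
  qed
  moreover have "A > 0" "B > 0" using K c by (simp_all add: A_def B_def)
  ultimately show thesis
    using that[of A B b] b(1) unfolding n_def s_def m_def by simp
qed

section \<open>Improper integrals of nonnegative functions\<close>

text \<open>On each \<open>{a..y}\<close> the integral is \<open>F y - F a\<close>, and exhausting
  the interval by such pieces gives the full integral as their supremum. Reading the integral as a
  measure \<open>N\<close> turns the exhaustion into continuity from below.\<close>

lemma nn_integral_infinite_iff_antiderivative_unbounded:
  fixes F h :: "real \<Rightarrow> real"
  assumes "a < b"
    and F: "\<And>x. a \<le> x \<Longrightarrow> x < b \<Longrightarrow> (F has_real_derivative h x) (at x)"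
    and h: "continuous_on {a..<b} h" "\<And>x. a \<le> x \<Longrightarrow> x < b \<Longrightarrow> 0 \<le> h x"
  shows "(\<integral>\<^sup>+ x\<in>{a<..<b}. ennreal (h x) \<partial>lborel) = \<infinity> \<longleftrightarrow> (\<forall>B. \<exists>x\<in>{a..<b}. F x > B)"
proof -
  \<comment> \<open>Extension by zero makes the integrand measurable on the whole line.\<close>
  define h' where "h' = (\<lambda>x. if x \<in> {a..<b} then h x else 0)"
  have meas: "h' \<in> borel_measurable borel"
    unfolding h'_def using h(1)
    by (intro borel_measurable_continuous_on_if) auto
  have Icc: "(\<integral>\<^sup>+ x\<in>{a..y}. ennreal (h' x) \<partial>lborel) = ennreal (F y - F a)"
    if "a \<le> y" "y < b" for y
    using that h(2) by (intro nn_integral_FTC_Icc meas) (auto simp: h'_def intro!: F)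
  define N where "N = density lborel (\<lambda>x. ennreal (h' x))"
  have N: "emeasure N X = (\<integral>\<^sup>+ x\<in>X. ennreal (h' x) \<partial>lborel)" if "X \<in> sets borel" for X
    using that meas by (simp add: N_def emeasure_density)
  have eq: "(\<integral>\<^sup>+ x\<in>{a<..<b}. ennreal (h x) \<partial>lborel) = emeasure N {a<..<b}"
    by (subst N) (auto intro!: nn_integral_cong simp: h'_def indicator_def)
  \<comment> \<open>The fundamental theorem concerns closed intervals, while the integral omits
    \<open>a\<close>; the point carries no mass.\<close>
  have null: "emeasure N {a} = 0"
    using Icc[of a] \<open>a < b\<close> by (simp add: N)
  have le: "ennreal (F y - F a) \<le> emeasure N {a<..<b}" if "a \<le> y" "y < b" for y
  proof -
    have "ennreal (F y - F a) = emeasure N {a..y}" using Icc[OF that] by (simp add: N)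
    also have "\<dots> \<le> emeasure N ({a<..<b} \<union> {a})"
      using that by (intro emeasure_mono) (auto simp: N_def)
    also have "\<dots> \<le> emeasure N {a<..<b} + emeasure N {a}"
      by (intro emeasure_subadditive) (auto simp: N_def)
    finally show ?thesis using null by simp
  qed
  show ?thesis
    unfolding eq
  proof
    assume inf: "emeasure N {a<..<b} = \<infinity>"
    show "\<forall>B. \<exists>x\<in>{a..<b}. F x > B"
    proof (rule ccontr)
      assume "\<not> ?thesis"
      then obtain B where "\<forall>x\<in>{a..<b}. F x \<le> B" by (auto simp: not_less)
      then have B: "\<And>x. a \<le> x \<Longrightarrow> x < b \<Longrightarrow> F x \<le> B" by simp
      \<comment> \<open>The sequence starts at \<open>a\<close> and increases to \<open>b\<close>
        without reaching it.\<close>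
      define x where "x = (\<lambda>n. b - (b - a) / real (Suc n))"
      have x: "a \<le> x n" "x n < b" for n
        using \<open>a < b\<close> by (simp_all add: x_def field_simps mult_right_mono)
      have "incseq x"
        unfolding x_def incseq_def using \<open>a < b\<close>
        by (auto intro!: divide_left_mono)
      have "x \<longlonglongrightarrow> b - 0"
        unfolding x_def by (intro tendsto_diff tendsto_const LIMSEQ_Suc lim_const_over_n)
      have "{a<..<b} = (\<Union>n. {a<..x n})"
      proof (intro equalityI subsetI)
        fix y assume y: "y \<in> {a<..<b}"
        then have "eventually (\<lambda>n. y < x n) sequentially"
          using \<open>x \<longlonglongrightarrow> b - 0\<close> by (intro order_tendstoD(1)) auto
        then obtain n where "y < x n" by (auto simp: eventually_sequentially)
        with y show "y \<in> (\<Union>n. {a<..x n})" by (auto intro: less_imp_le)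
      qed (use x le_less_trans in fastforce)
      also have "emeasure N \<dots> = (SUP n. emeasure N {a<..x n})"
      proof (rule SUP_emeasure_incseq[symmetric])
        have "{a<..x i} \<subseteq> {a<..x j}" if "i \<le> j" for i j
          using incseqD[OF \<open>incseq x\<close> that] by auto
        then show "incseq (\<lambda>n. {a<..x n})" by (simp add: incseq_def)
      qed (auto simp: N_def)
      also have "\<dots> \<le> ennreal (B - F a)"
      proof (intro SUP_least)
        fix n
        have "emeasure N {a<..x n} \<le> emeasure N {a..x n}"
          by (intro emeasure_mono) (auto simp: N_def)
        also have "\<dots> = ennreal (F (x n) - F a)" using Icc[OF x] by (simp add: N)
        also have "\<dots> \<le> ennreal (B - F a)" using B[OF x] by (intro ennreal_leI) simp
        finally show "emeasure N {a<..x n} \<le> ennreal (B - F a)" .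
      qed
      finally show False using inf by (simp add: top_unique)
    qed
  next
    assume unb: "\<forall>B. \<exists>x\<in>{a..<b}. F x > B"
    show "emeasure N {a<..<b} = \<infinity>"
    proof (rule ccontr)
      assume "emeasure N {a<..<b} \<noteq> \<infinity>"
      then obtain C where C: "emeasure N {a<..<b} = ennreal C" "C \<ge> 0"
        by (cases "emeasure N {a<..<b}") auto
      obtain y where "y \<in> {a..<b}" "F y > F a + C" using unb by blast
      with le[of y] C show False by simp
    qed
  qed
qed

section \<open>The criterion for a finite endpoint and the limit of the slope\<close>

theorem theorem18:
  fixes p c c1 c2 \<delta> lam :: real
    and f g \<rho> d u :: "real \<Rightarrow> real"
    and \<alpha> \<beta> :: ereal
  assumes "standing_assumptions p f g \<rho> d"
    and "traveling_wave p f g \<rho> d c \<alpha> \<beta> u"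
    and "c1 > 0" and "c2 > 0" and "\<delta> > 0"
    and "-1 < lam" and "lam \<le> 1 / (p - 1)"
    and "\<forall>v\<in>{0<..<1} \<inter> {1 - \<delta><..<1}.
           c1 * (1 - v) powr lam \<le> \<rho> v * d v powr (1 / (p - 1)) \<and>
           \<rho> v * d v powr (1 / (p - 1)) \<le> c2 * (1 - v) powr lam"
  shows "(\<alpha> = -\<infinity> \<longleftrightarrow>
           (\<integral>\<^sup>+ v\<in>{1/2<..<1}. ennreal ((1 - v) powr (lam - (lam + 1) / p) / \<rho> v) \<partial>lborel) = \<infinity>) \<and>
         (\<alpha> > -\<infinity> \<longrightarrow> ((deriv u \<circ> real_of_ereal) \<longlongrightarrow> 0) (at_right \<alpha>))"
proof -
  define I where "I = (\<lambda>v. (1 - v) powr (lam - (lam + 1) / p) / \<rho> v)"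
  let ?R = "\<lambda>v. \<rho> v / (1 - v) powr (lam - (lam + 1) / p)"
  note sa = assms(1) and tw = assms(2)
  obtain A B b where AB: "A > 0" "B > 0" and b: "b \<in> einterval \<alpha> \<beta>"
    and speed: "\<And>t. t \<in> einterval \<alpha> (ereal b) \<Longrightarrow>
      u t > 1 / 2 \<and> A * ?R (u t) \<le> - deriv u t \<and> - deriv u t \<le> B * ?R (u t)"
    using traveling_wave_speed_bounds[OF assms] by blast
  let ?J = "einterval \<alpha> (ereal b)"
  have p: "p > 1" and \<rho>_cont: "continuous_on {0..1} \<rho>" and \<rho>1: "\<rho> 1 = 0"
    and \<rho>_pos: "\<And>v. 0 < v \<Longrightarrow> v < 1 \<Longrightarrow> \<rho> v > 0"
    using sa unfolding standing_assumptions_def by simp_all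
  have \<alpha>\<beta>: "\<alpha> < \<beta>" and lim_u: "((u \<circ> real_of_ereal) \<longlongrightarrow> 1) (at_right \<alpha>)"
    using tw unfolding traveling_wave_def by simp_all
  have sub: "t \<in> einterval \<alpha> \<beta>" if "t \<in> ?J" for t
    using einterval_subset_left[OF b that] .
  have u01: "0 < u t" "u t < 1" if "t \<in> ?J" for t
    using tw sub[OF that] unfolding traveling_wave_def by simp_all
  have I_pos: "I v > 0" if "0 < v" "v < 1" for v
    using \<rho>_pos that by (simp add: I_def)
  have I_cont: "isCont I v" if "0 < v" "v < 1" for v
  proof -
    have "isCont \<rho> v" using \<rho>_cont that by (intro continuous_on_interior) auto
    then show ?thesis
      using \<rho>_pos[OF that] that unfolding I_def by (intro continuous_intros) auto
  qed
  have "\<exists>F. \<forall>x. ereal 0 < ereal x \<longrightarrow> ereal x < ereal 1 \<longrightarrow> (F has_vector_derivative I x) (at x)"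
    by (rule einterval_antiderivative) (auto intro: I_cont simp: zero_ereal_def one_ereal_def)
  then obtain F where F: "\<And>x. 0 < x \<Longrightarrow> x < 1 \<Longrightarrow> (F has_real_derivative I x) (at x)"
    by (auto simp: has_real_derivative_iff_has_vector_derivative zero_ereal_def one_ereal_def)
  have inf_iff: "(\<integral>\<^sup>+ v\<in>{1/2<..<1}. ennreal (I v) \<partial>lborel) = \<infinity> \<longleftrightarrow>
      (\<forall>X. \<exists>x\<in>{1/2..<1}. F x > X)"
    by (intro nn_integral_infinite_iff_antiderivative_unbounded)
       (auto intro!: F continuous_at_imp_continuous_on I_cont less_imp_le[OF I_pos])
  \<comment> \<open>\<open>I\<close> is the reciprocal of \<open>?R\<close>, so the slope bounds
    place the derivative of \<open>F (u z)\<close> between \<open>-B\<close> and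
    \<open>-A\<close>.\<close>
  have mvt: "A * (y - x) \<le> F (u x) - F (u y) \<and> F (u x) - F (u y) \<le> B * (y - x)"
    if "x \<in> ?J" "y \<in> ?J" "x < y" for x y
  proof -
    have J: "z \<in> ?J" if "x \<le> z" "z \<le> y" for z
      using einterval_mem_between[OF \<open>x \<in> ?J\<close> \<open>y \<in> ?J\<close> that] .
    have "((\<lambda>z. F (u z)) has_real_derivative I (u z) * deriv u z) (at z)"
      if "x \<le> z" "z \<le> y" for z
      using DERIV_chain2[OF F traveling_wave_DERIV(1)[OF tw]] u01 J[OF that] sub by blast
    from MVT2[OF \<open>x < y\<close> this] obtain z where z: "x < z" "z < y"
      "F (u y) - F (u x) = (y - x) * (I (u z) * deriv u z)" by blast
    have zJ: "z \<in> ?J" using J z by simp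
    have i: "I (u z) > 0" and IR: "I (u z) * ?R (u z) = 1"
      using I_pos \<rho>_pos[of "u z"] u01[OF zJ] by (auto simp: I_def)
    have IK: "I (u z) * (K * ?R (u z)) = K" for K
      by (subst mult.left_commute) (simp only: IR mult_1_right)
    have "A * ?R (u z) \<le> - deriv u z" "- deriv u z \<le> B * ?R (u z)"
      using speed[OF zJ] by blast+
    from this[THEN mult_left_mono, OF less_imp_le[OF i]]
    have "A \<le> I (u z) * - deriv u z" "I (u z) * - deriv u z \<le> B"
      by (simp_all only: IK)
    from this[THEN mult_right_mono, of "y - x"] z show ?thesis
      by (simp add: algebra_simps)
  qed
  obtain t' where t': "t' \<in> ?J"
    using b ereal_dense2[of \<alpha> "ereal b"] by (auto simp: einterval_def)
  have "\<alpha> = -\<infinity> \<longleftrightarrow> (\<integral>\<^sup>+ v\<in>{1/2<..<1}. ennreal (I v) \<partial>lborel) = \<infinity>"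
    unfolding inf_iff
  proof
    assume \<alpha>: "\<alpha> = -\<infinity>"
    show "\<forall>X. \<exists>x\<in>{1/2..<1}. F x > X"
    proof
      fix X
      \<comment> \<open>Going back this far makes the gain \<open>A * (t' - t)\<close> equal to
        \<open>\<bar>X - F (u t')\<bar> + 1\<close>, which lifts \<open>F (u t)\<close> above
        \<open>X\<close>; \<open>\<alpha> = -\<infinity>\<close> leaves room for it.\<close>
      define t where "t = t' - (\<bar>X - F (u t')\<bar> + 1) / A"
      have "t < t'" using AB by (simp add: t_def add_nonneg_pos)
      then have tJ: "t \<in> ?J" using t' \<alpha> by (simp add: einterval_def)
      have "A * (t' - t) = \<bar>X - F (u t')\<bar> + 1" using AB by (simp add: t_def)
      then have "F (u t) > X" using mvt[OF tJ t' \<open>t < t'\<close>] by linarith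
      moreover have "u t \<in> {1/2..<1}" using speed[OF tJ] u01[OF tJ] by simp
      ultimately show "\<exists>x\<in>{1/2..<1}. F x > X" by blast
    qed
  next
    assume unb: "\<forall>X. \<exists>x\<in>{1/2..<1}. F x > X"
    show "\<alpha> = -\<infinity>"
    proof (rule ccontr)
      assume "\<alpha> \<noteq> -\<infinity>"
      then obtain a where a: "\<alpha> = ereal a" using \<alpha>\<beta> by (cases \<alpha>) auto
      \<comment> \<open>On a finite stretch of time \<open>F (u t)\<close> cannot exceed this bound.
        But \<open>u\<close> passes \<open>x\<close> on its way to 1, and \<open>F\<close> is
        nondecreasing.\<close>
      obtain x where x: "x \<in> {1/2..<1}" "F x > F (u t') + B * (t' - a)" using unb by blast
      have "(((\<lambda>t. - u t) \<circ> real_of_ereal) \<longlongrightarrow> - 1) (at_right \<alpha>)"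
        using tendsto_minus[OF lim_u] by (simp add: o_def)
      from einterval_at_right_less[OF this _ t', of "- x"] obtain t
        where t: "t \<in> einterval \<alpha> (ereal t')" "x < u t" using x by auto
      have tJ: "t \<in> ?J" and tt': "t < t'" "a < t"
        using einterval_subset_left[OF t' t(1)] t(1) a by (auto simp: einterval_def)
      have "F x \<le> F (u t)"
        using t x u01[OF tJ]
        by (intro DERIV_nonneg_imp_nondecreasing[of x "u t" F])
           (auto intro!: exI[of _ "I _"] F less_imp_le[OF I_pos])
      also have "\<dots> \<le> F (u t') + B * (t' - t)" using mvt[OF tJ t' tt'(1)] by simp
      also have "\<dots> \<le> F (u t') + B * (t' - a)" using AB tt' by simp
      finally show False using x by simp
    qed
  qed
  moreover have "((deriv u \<circ> real_of_ereal) \<longlongrightarrow> 0) (at_right \<alpha>)"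
  proof -
    have ev: "eventually P (at_right \<alpha>)" if "\<And>t. t \<in> ?J \<Longrightarrow> P (ereal t)" for P
      using that b eventually_at_right_einterval[OF \<alpha>\<beta>, of P] by blast
    have "((\<lambda>x. \<rho> (u (real_of_ereal x))) \<longlongrightarrow> \<rho> 1) (at_right \<alpha>)"
      using lim_u unfolding o_def
      by (intro continuous_on_tendsto_compose[OF \<rho>_cont])
         (auto intro!: ev less_imp_le u01)
    then have "((\<lambda>x. B * \<rho> (u (real_of_ereal x))) \<longlongrightarrow> 0) (at_right \<alpha>)"
      using tendsto_mult_right_zero \<rho>1 by fastforce
    \<comment> \<open>The exponent \<open>lam - (lam + 1) / p\<close> is at most 0, so the power of
      \<open>1 - u t\<close> in the denominator of \<open>?R\<close> is at least 1 and may be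
      dropped.\<close>
    moreover have "norm (deriv u t) \<le> B * \<rho> (u t)" if t: "t \<in> ?J" for t
    proof -
      have "lam * (p - 1) \<le> 1" using assms(7) p by (simp add: field_simps)
      then have "lam - (lam + 1) / p \<le> 0" using p by (simp add: field_simps)
      then have "1 \<le> (1 - u t) powr (lam - (lam + 1) / p)"
        using powr_mono'[of "lam - (lam + 1) / p" 0 "1 - u t"] u01[OF t] by simp
      then have "?R (u t) \<le> \<rho> (u t) / 1"
        using \<rho>_pos[OF u01[OF t]] by (intro divide_left_mono) auto
      then have "B * ?R (u t) \<le> B * \<rho> (u t)" using AB by (intro mult_left_mono) auto
      then show ?thesis
        using speed[OF t] traveling_wave_deriv_neg[OF sa tw sub[OF t]] by simp
    qed
    ultimately show ?thesis
      by (elim Lim_null_comparison[rotated]) (auto intro!: ev)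
  qed
  ultimately show ?thesis unfolding I_def by blast
qed

end
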